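(* Let $E$ be a Dedekind complete vector lattice and let $T$ be a positive operator on $E$ which admits a superinvariant pair $(e,\varphi)$. Let $A_n := \frac1n\sum_{k=0}^{n-1} T^k$, $n \in \mathbb{N}$. For $x \in E_+$, $\lambda > 0$ and $N \in \mathbb{N}$, let $P_{N,\lambda}$ be the band projection onto the band generated by $\sup_{1 \le n \le N} (A_n x - \lambda e)^+$. Then $$\lambda\, \varphi(P_{N,\lambda} e) \le \varphi(x)$$ for all $N \in \mathbb{N}$, $\lambda > 0$ and $x \in E_+$.
   Context: A positive operator is a linear map $T \colon E \to E$ with $T(E_+) \subseteq E_+$. A pair $(e,\varphi)$ is a superinvariant pair for $T$ if: (a) $e \in E_+$ is a weak unit (i.e. $x \wedge e = 0$, $x \in E_+$, imply $x=0$) and $Te \le e$; (b) $\varphi$ is a positive linear functional on $E$ that is strictly positive ($\varphi(x) > 0$ for each $0 < x \in E_+$), $\sigma$-order continuous ($x_n \downarrow 0$ implies $\varphi(x_n) \to 0$ for sequences), and satisfies $T'\varphi \le \varphi$, i.e. $\varphi(Tx) \le \varphi(x)$ for all $x \in E_+$. In a Dedekind complete vector lattice every band $B$ satisfies $E = B \oplus B^\perp$, and the band projection onto $B$ is the projection onto $B$ with kernel $B^\perp$. *)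

theory Defs
  imports Complex_Main "HOL-Library.Lattice_Algebras"
begin

text \<open>
  A (real) vector lattice in which nonempty order-bounded sets have suprema and infima.
  The modulus is the lattice one, \<open>\<bar>x\<bar> = sup x (- x)\<close>, and the positive part
  is the library's \<open>pprt x = sup x 0\<close>.
\<close>

class dedekind_complete_vector_lattice =
  ordered_real_vector + lattice_ab_group_add_abs + conditionally_complete_lattice

definition positive_operator :: "('a::ordered_real_vector \<Rightarrow> 'a) \<Rightarrow> bool" where
  "positive_operator T \<longleftrightarrow> linear T \<and> (\<forall>x\<ge>0. 0 \<le> T x)"

definition weak_unit :: "'a::dedekind_complete_vector_lattice \<Rightarrow> bool" where
  "weak_unit e \<longleftrightarrow> 0 \<le> e \<and> (\<forall>x\<ge>0. inf x e = 0 \<longrightarrow> x = 0)"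

definition positive_functional :: "('a::ordered_real_vector \<Rightarrow> real) \<Rightarrow> bool" where
  "positive_functional \<phi> \<longleftrightarrow> linear \<phi> \<and> (\<forall>x\<ge>0. 0 \<le> \<phi> x)"

definition strictly_positive :: "('a::ordered_real_vector \<Rightarrow> real) \<Rightarrow> bool" where
  "strictly_positive \<phi> \<longleftrightarrow> (\<forall>x>0. 0 < \<phi> x)"

text \<open>
  The lower bound \<open>0\<close> is required explicitly because \<open>Inf\<close> is unspecified on
  sets that are not bounded below.
\<close>

definition decreases_to_zero :: "(nat \<Rightarrow> 'a::dedekind_complete_vector_lattice) \<Rightarrow> bool" where
  "decreases_to_zero u \<longleftrightarrow> decseq u \<and> (\<forall>n. 0 \<le> u n) \<and> (INF n. u n) = 0"

definition sigma_order_continuous :: "('a::dedekind_complete_vector_lattice \<Rightarrow> real) \<Rightarrow> bool" where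
  "sigma_order_continuous \<phi> \<longleftrightarrow>
     (\<forall>u. decreases_to_zero u \<longrightarrow> (\<lambda>n. \<phi> (u n)) \<longlonglongrightarrow> 0)"

definition superinvariant_pair ::
  "('a::dedekind_complete_vector_lattice \<Rightarrow> 'a) \<Rightarrow> 'a \<Rightarrow> ('a \<Rightarrow> real) \<Rightarrow> bool" where
  "superinvariant_pair T e \<phi> \<longleftrightarrow>
     weak_unit e \<and> T e \<le> e \<and>
     positive_functional \<phi> \<and> strictly_positive \<phi> \<and> sigma_order_continuous \<phi> \<and>
     (\<forall>x\<ge>0. \<phi> (T x) \<le> \<phi> x)"

definition cesaro_mean :: "('a::real_vector \<Rightarrow> 'a) \<Rightarrow> nat \<Rightarrow> 'a \<Rightarrow> 'a" where
  "cesaro_mean T n x = (1 / real n) *\<^sub>R (\<Sum>k<n. (T ^^ k) x)"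

definition order_ideal :: "'a::dedekind_complete_vector_lattice set \<Rightarrow> bool" where
  "order_ideal B \<longleftrightarrow> subspace B \<and> (\<forall>x y. y \<in> B \<and> \<bar>x\<bar> \<le> \<bar>y\<bar> \<longrightarrow> x \<in> B)"

definition band :: "'a::dedekind_complete_vector_lattice set \<Rightarrow> bool" where
  "band B \<longleftrightarrow> order_ideal B \<and> (\<forall>S. S \<subseteq> B \<and> S \<noteq> {} \<and> bdd_above S \<longrightarrow> Sup S \<in> B)"

definition band_generated_by :: "'a::dedekind_complete_vector_lattice \<Rightarrow> 'a set" where
  "band_generated_by u = \<Inter> {B. band B \<and> u \<in> B}"

definition disjoint_complement ::
  "'a::dedekind_complete_vector_lattice set \<Rightarrow> 'a set" where
  "disjoint_complement B = {x. \<forall>y\<in>B. inf \<bar>x\<bar> \<bar>y\<bar> = 0}"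

text \<open>
  The projection onto \<open>B\<close> along its disjoint complement: the component in \<open>B\<close> of the
  decomposition of \<open>x\<close>. The description is proper when \<open>B\<close> is a band, since bands in a
  Dedekind complete vector lattice are complemented by their disjoint complements.
\<close>

definition band_projection ::
  "'a::dedekind_complete_vector_lattice set \<Rightarrow> 'a \<Rightarrow> 'a" where
  "band_projection B x = (THE y. y \<in> B \<and> x - y \<in> disjoint_complement B)"

end

theory Submission imports Defs begin

text \<open>
  Garsia's argument. Put \<open>f = x - \<lambda>e\<close>, \<open>S n = f + T f + \<dots> + T\<^sup>n\<^sup>-\<^sup>1 f\<close>, let \<open>W\<close> be the
  supremum of \<open>S 1, \<dots>, S N\<close>, and let \<open>P\<close> be the projection onto the band generated by
  \<open>M = W\<^sup>+\<close>. From \<open>S (n + 1) = f + T (S n)\<close> one gets \<open>W \<le> f + T M\<close>, and \<open>P W = M\<close>, so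
  \<open>M \<le> P f + T M\<close>. Since \<open>\<phi> (T M) \<le> \<phi> M\<close>, this gives \<open>0 \<le> \<phi> (P f)\<close>, which is
  \<open>\<lambda> \<phi> (P e) \<le> \<phi> (P x) \<le> \<phi> x\<close>. Finally \<open>T e \<le> e\<close> implies
  \<open>n (A\<^sub>n x - \<lambda>e) \<le> S n\<close>, so the band generated by
  the supremum of the \<open>(A\<^sub>n x - \<lambda>e)\<^sup>+\<close> is contained in the one generated by \<open>M\<close>.
\<close>

section \<open>Disjointness\<close>

text \<open>Addition distributes over \<open>inf\<close>, so the right side is the infimum of
  \<open>inf a c + b\<close> and \<open>inf a c + c\<close>. The left side lies below each of these
  because \<open>a\<close>, \<open>b\<close>, \<open>c\<close> are nonnegative.\<close>

lemma inf_add_le: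
  fixes a b c :: "'a::lattice_ab_group_add"
  assumes "0 \<le> a" "0 \<le> b" "0 \<le> c"
  shows "inf (a + b) c \<le> inf a c + inf b c"
proof -
  have "inf (a + b) c \<le> inf a c + c"
    using assms by (intro order_trans[OF inf_le2]) simp
  moreover have "inf (a + b) c \<le> inf a c + b"
    using assms le_infI2[of c "c + b"] by (simp add: add_inf_distrib_right)
  ultimately show ?thesis by (simp add: add_inf_distrib_left)
qed

text \<open>Pulling the common summand \<open>pprt a\<close> out of the infimum leaves
  \<open>inf 0 (- a)\<close>, which is \<open>- pprt a\<close>.\<close>

lemma inf_pprt_pprt_uminus:
  fixes a :: "'a::lattice_ab_group_add"
  shows "inf (pprt a) (pprt (- a)) = 0"
proof -
  have "pprt (- a) = pprt a - a"
    using prts[of a] by (simp add: pprt_neg algebra_simps)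
  then have "inf (pprt a) (pprt (- a)) = inf (pprt a + 0) (pprt a + - a)"
    by simp
  also have "\<dots> = pprt a + inf 0 (- a)"
    by (rule add_inf_distrib_left[symmetric])
  also have "inf 0 (- a) = - pprt a"
    by (simp add: pprt_def inf_commute)
  finally show ?thesis by simp
qed

lemma abs_scaleR_le:
  fixes x :: "'a::dedekind_complete_vector_lattice"
  shows "\<bar>c *\<^sub>R x\<bar> \<le> \<bar>c\<bar> *\<^sub>R \<bar>x\<bar>"
proof -
  have le: "d *\<^sub>R y \<le> \<bar>d\<bar> *\<^sub>R \<bar>y\<bar>" for d and y :: 'a
  proof (cases "0 \<le> d")
    case True
    then show ?thesis by (simp add: scaleR_left_mono abs_ge_self)
  next
    case False
    then have "(- d) *\<^sub>R (- y) \<le> (- d) *\<^sub>R \<bar>y\<bar>"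
      by (intro scaleR_left_mono) (auto simp: abs_ge_minus_self)
    with False show ?thesis by simp
  qed
  show ?thesis
    using le[of c x] le[of "- c" x] by (intro abs_leI) simp_all
qed

lemma inf_scaleR_eq_0:
  fixes a b :: "'a::dedekind_complete_vector_lattice"
  assumes "0 \<le> a" "0 \<le> b" "inf a b = 0" "0 \<le> r"
  shows "inf (r *\<^sub>R a) b = 0"
proof -
  \<comment> \<open>Since \<open>m\<close> dominates \<open>r\<close>, dividing \<open>w\<close> by
    \<open>m\<close> gives an element below \<open>a\<close>; since \<open>m\<close> is at least 1,
    that element is still below \<open>b\<close>. It is therefore below
    \<open>inf a b = 0\<close>.\<close>
  define m where "m = max 1 r"
  have m: "1 \<le> m" "r \<le> m" by (auto simp: m_def)
  define w where "w = inf (r *\<^sub>R a) b"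
  have w0: "0 \<le> w" using assms by (simp add: w_def scaleR_nonneg_nonneg)
  have "w \<le> m *\<^sub>R a"
    unfolding w_def using m assms by (intro order_trans[OF inf_le1] scaleR_right_mono) auto
  then have "(1 / m) *\<^sub>R w \<le> (1 / m) *\<^sub>R (m *\<^sub>R a)"
    using m by (intro scaleR_left_mono) auto
  then have 1: "(1 / m) *\<^sub>R w \<le> a" using m by simp
  have "(1 / m) *\<^sub>R w \<le> 1 *\<^sub>R w"
    using m w0 by (intro scaleR_right_mono) auto
  also have "\<dots> \<le> b" by (simp add: w_def)
  finally have "(1 / m) *\<^sub>R w \<le> 0" using 1 assms(3) by (metis inf.boundedI)
  then have "m *\<^sub>R ((1 / m) *\<^sub>R w) \<le> m *\<^sub>R 0"
    using m by (intro scaleR_left_mono) auto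
  then have "w \<le> 0" using m by simp
  with w0 show ?thesis unfolding w_def by (rule antisym[rotated])
qed

lemma subspace_disjoint_complement:
  fixes B :: "'a::dedekind_complete_vector_lattice set"
  shows "subspace (disjoint_complement B)"
proof (rule subspaceI)
  show "0 \<in> disjoint_complement B"
    by (simp add: disjoint_complement_def inf_absorb1)
next
  fix x y assume xy: "x \<in> disjoint_complement B" "y \<in> disjoint_complement B"
  show "x + y \<in> disjoint_complement B"
    unfolding disjoint_complement_def
  proof (intro CollectI ballI antisym)
    fix b assume "b \<in> B"
    have "inf \<bar>x + y\<bar> \<bar>b\<bar> \<le> inf (\<bar>x\<bar> + \<bar>y\<bar>) \<bar>b\<bar>"
      by (intro inf_mono abs_triangle_ineq order_refl)
    also have "\<dots> \<le> inf \<bar>x\<bar> \<bar>b\<bar> + inf \<bar>y\<bar> \<bar>b\<bar>" by (intro inf_add_le) auto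
    also have "\<dots> = 0" using xy \<open>b \<in> B\<close> by (simp add: disjoint_complement_def)
    finally show "inf \<bar>x + y\<bar> \<bar>b\<bar> \<le> 0" .
  qed simp
next
  fix c x assume x: "x \<in> disjoint_complement B"
  show "c *\<^sub>R x \<in> disjoint_complement B"
    unfolding disjoint_complement_def
  proof (intro CollectI ballI antisym)
    fix b assume "b \<in> B"
    have "inf \<bar>c *\<^sub>R x\<bar> \<bar>b\<bar> \<le> inf (\<bar>c\<bar> *\<^sub>R \<bar>x\<bar>) \<bar>b\<bar>"
      by (intro inf_mono abs_scaleR_le order_refl)
    also have "\<dots> = 0"
      using x \<open>b \<in> B\<close> by (intro inf_scaleR_eq_0) (auto simp: disjoint_complement_def)
    finally show "inf \<bar>c *\<^sub>R x\<bar> \<bar>b\<bar> \<le> 0" .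
  qed simp
qed

lemma order_ideal_disjoint_complement:
  fixes B :: "'a::dedekind_complete_vector_lattice set"
  shows "order_ideal (disjoint_complement B)"
  unfolding order_ideal_def
proof (intro conjI allI impI subspace_disjoint_complement)
  fix x y assume *: "y \<in> disjoint_complement B \<and> \<bar>x\<bar> \<le> \<bar>y\<bar>"
  have "inf \<bar>x\<bar> \<bar>b\<bar> = 0" if "b \<in> B" for b
  proof (rule antisym)
    have "inf \<bar>x\<bar> \<bar>b\<bar> \<le> inf \<bar>y\<bar> \<bar>b\<bar>" using * by (intro inf_mono) auto
    also have "\<dots> = 0" using * that by (simp add: disjoint_complement_def)
    finally show "inf \<bar>x\<bar> \<bar>b\<bar> \<le> 0" .
  qed simp
  then show "x \<in> disjoint_complement B" by (simp add: disjoint_complement_def)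
qed

text \<open>Closure under suprema is checked relative to a fixed member \<open>s0\<close>: the
  complement is a subspace, so it is enough that \<open>s - s0\<close> lies in it. This difference
  is nonnegative, which removes the modulus and makes \<open>inf_add_le\<close> applicable.\<close>

lemma band_disjoint_complement:
  fixes B :: "'a::dedekind_complete_vector_lattice set"
  shows "band (disjoint_complement B)"
  unfolding band_def
proof (intro conjI allI impI order_ideal_disjoint_complement)
  fix S assume S: "S \<subseteq> disjoint_complement B \<and> S \<noteq> {} \<and> bdd_above S"
  let ?C = "disjoint_complement B"
  define s where "s = Sup S"
  obtain s0 where s0: "s0 \<in> S" using S by blast
  have up: "t \<le> s" if "t \<in> S" for t
    unfolding s_def using S that by (intro cSup_upper) auto
  have diff: "s - s0 \<in> ?C"
    unfolding disjoint_complement_def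
  proof (intro CollectI ballI antisym)
    fix b assume b: "b \<in> B"
    define w where "w = inf (s - s0) \<bar>b\<bar>"
    \<comment> \<open>\<open>s - w\<close> is still an upper bound of \<open>S\<close>, so \<open>w = 0\<close>; no infinite distributive law is needed.\<close>
    have "t \<le> s - w" if t: "t \<in> S" for t
    proof -
      \<comment> \<open>Replacing \<open>t\<close> by \<open>r\<close> makes \<open>r - s0\<close>
        the positive part of \<open>t - s0\<close>, which stays in the ideal. It also splits
        \<open>s - s0\<close> into two nonnegative summands, the second of them disjoint from
        \<open>b\<close>.\<close>
      define r where "r = sup t s0"
      have r: "t \<le> r" "s0 \<le> r" "r \<le> s" using up t s0 by (simp_all add: r_def)
      have "r - s0 = sup (t - s0) 0"
        by (simp add: r_def diff_conv_add_uminus add_sup_distrib_right del: add_uminus_conv_diff)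
      then have "\<bar>r - s0\<bar> \<le> \<bar>t - s0\<bar>"
        by (simp add: abs_of_nonneg abs_ge_self)
      moreover have "t - s0 \<in> ?C"
        using S t s0 by - (rule subspace_diff[OF subspace_disjoint_complement], auto)
      ultimately have "r - s0 \<in> ?C"
        using order_ideal_disjoint_complement[of B] unfolding order_ideal_def by blast
      then have "inf \<bar>r - s0\<bar> \<bar>b\<bar> = 0" using b by (simp add: disjoint_complement_def)
      then have 0: "inf (r - s0) \<bar>b\<bar> = 0" by (simp add: abs_of_nonneg r)
      have "s - s0 = (s - r) + (r - s0)" by simp
      then have "w = inf ((s - r) + (r - s0)) \<bar>b\<bar>" unfolding w_def by (rule arg_cong)
      also have "\<dots> \<le> inf (s - r) \<bar>b\<bar> + inf (r - s0) \<bar>b\<bar>"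
        using r by (intro inf_add_le) auto
      also have "\<dots> \<le> s - r" using 0 by simp
      finally have "r \<le> s - w" by (simp add: algebra_simps)
      then show ?thesis by (rule order_trans[OF r(1)])
    qed
    then have "s \<le> s - w" unfolding s_def using S by (intro cSup_least) auto
    then have "w \<le> 0" by simp
    then show "inf \<bar>s - s0\<bar> \<bar>b\<bar> \<le> 0" using up[OF s0] by (simp add: w_def abs_of_nonneg)
  qed simp
  have "(s - s0) + s0 \<in> ?C"
    using S s0 diff by - (rule subspace_add[OF subspace_disjoint_complement], auto)
  then show "Sup S \<in> ?C" by (simp add: s_def)
qed

section \<open>Band projections\<close>

lemma band_ideal: "band B \<Longrightarrow> y \<in> B \<Longrightarrow> \<bar>x\<bar> \<le> \<bar>y\<bar> \<Longrightarrow> x \<in> B"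
  unfolding band_def order_ideal_def by blast

lemma band_subspace: "band B \<Longrightarrow> subspace B"
  by (simp add: band_def order_ideal_def)

lemma band_band_generated_by: "band (band_generated_by u)"
proof -
  have "subspace (band_generated_by u)"
    unfolding band_generated_by_def
    by (rule subspace_Inter) (auto simp: band_def order_ideal_def)
  moreover have "x \<in> band_generated_by u" if "y \<in> band_generated_by u" "\<bar>x\<bar> \<le> \<bar>y\<bar>" for x y
    using that band_ideal unfolding band_generated_by_def by blast
  moreover have "Sup S \<in> band_generated_by u"
    if "S \<subseteq> band_generated_by u" "S \<noteq> {}" "bdd_above S" for S
    unfolding band_generated_by_def
  proof
    fix B assume B: "B \<in> {B. band B \<and> u \<in> B}"
    then have "S \<subseteq> B" using that(1) by (auto simp: band_generated_by_def)
    with B that show "Sup S \<in> B" by (simp add: band_def)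
  qed
  ultimately show ?thesis
    unfolding band_def order_ideal_def by blast
qed

lemma generator_in_band: "u \<in> band_generated_by u"
  by (simp add: band_generated_by_def)

lemma band_generated_by_subset: "band B \<Longrightarrow> u \<in> B \<Longrightarrow> band_generated_by u \<subseteq> B"
  by (auto simp: band_generated_by_def)

text \<open>Disjointness is symmetric, and the complement of \<open>{z}\<close> is a band; once it
  contains \<open>u\<close>, it contains the whole band generated by \<open>u\<close>.\<close>

lemma disjoint_complement_band_generated_by:
  assumes "inf \<bar>z\<bar> \<bar>u\<bar> = 0"
  shows "z \<in> disjoint_complement (band_generated_by u)"
proof -
  have "u \<in> disjoint_complement {z}"
    using assms by (simp add: disjoint_complement_def inf_commute)
  then have "band_generated_by u \<subseteq> disjoint_complement {z}"
    by (intro band_generated_by_subset band_disjoint_complement)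
  then show ?thesis by (auto simp: disjoint_complement_def inf_commute)
qed

text \<open>Two candidates differ by an element lying both in \<open>B\<close> and in its
  complement. Such an element is disjoint from itself, hence zero, so the definite description is
  justified.\<close>

lemma band_projectionI:
  assumes B: "band B" and y: "y \<in> B" "x - y \<in> disjoint_complement B"
  shows "band_projection B x = y"
  unfolding band_projection_def
proof (rule the_equality)
  fix z assume z: "z \<in> B \<and> x - z \<in> disjoint_complement B"
  have "z - y \<in> B" using z y by - (rule subspace_diff[OF band_subspace[OF B]], auto)
  moreover have "(x - y) - (x - z) \<in> disjoint_complement B"
    using z y by - (rule subspace_diff[OF subspace_disjoint_complement], auto)
  then have "z - y \<in> disjoint_complement B" by simp
  ultimately have "inf \<bar>z - y\<bar> \<bar>z - y\<bar> = 0" unfolding disjoint_complement_def by blast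
  then show "z = y" by simp
qed (use y in auto)

text \<open>Riesz decomposition: the component in \<open>B\<close> is the largest element of
  \<open>B\<close> between 0 and \<open>x\<close>, which exists by Dedekind completeness.\<close>

lemma band_decomposition_nonneg:
  fixes x :: "'a::dedekind_complete_vector_lattice"
  assumes B: "band B" and x: "0 \<le> x"
  obtains y where "y \<in> B" "x - y \<in> disjoint_complement B" "0 \<le> y" "y \<le> x"
proof
  define S where "S = {z \<in> B. 0 \<le> z \<and> z \<le> x}"
  define p where "p = Sup S"
  have S0: "0 \<in> S" using x subspace_0[OF band_subspace[OF B]] by (simp add: S_def)
  have bdd: "bdd_above S" unfolding S_def by (rule bdd_aboveI[of _ x]) simp
  have "S \<subseteq> B" "S \<noteq> {}" using S0 by (auto simp: S_def)
  then show pB: "p \<in> B" using B bdd by (simp add: p_def band_def)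
  show p0: "0 \<le> p" unfolding p_def by (rule cSup_upper[OF S0 bdd])
  show px: "p \<le> x" unfolding p_def by (rule cSup_least) (use S0 in \<open>auto simp: S_def\<close>)
  show "x - p \<in> disjoint_complement B"
    unfolding disjoint_complement_def
  proof (intro CollectI ballI antisym)
    fix b assume b: "b \<in> B"
    \<comment> \<open>The overlap \<open>c\<close> belongs to \<open>B\<close> and
      \<open>p + c\<close> is still below \<open>x\<close>, so maximality of \<open>p\<close> forces
      \<open>c\<close> to vanish.\<close>
    define c where "c = inf (x - p) \<bar>b\<bar>"
    have c0: "0 \<le> c" using px by (simp add: c_def)
    then have "\<bar>c\<bar> \<le> \<bar>b\<bar>" by (simp add: c_def)
    then have "c \<in> B" using B b by (rule band_ideal[rotated 2])
    then have "p + c \<in> B" using pB by - (rule subspace_add[OF band_subspace[OF B]], auto)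
    moreover have "p + c \<le> p + (x - p)" by (intro add_left_mono) (simp add: c_def)
    ultimately have "p + c \<in> S" using p0 c0 by (simp add: S_def)
    then have "p + c \<le> p" unfolding p_def by (intro cSup_upper bdd)
    then show "inf \<bar>x - p\<bar> \<bar>b\<bar> \<le> 0" using px by (simp add: c_def abs_of_nonneg)
  qed simp
qed

lemma band_projection_nonneg:
  assumes "band B" "0 \<le> x"
  shows "0 \<le> band_projection B x" "band_projection B x \<le> x"
  using band_decomposition_nonneg[OF assms] band_projectionI[OF assms(1)] by metis+

text \<open>The nonnegative case is applied to \<open>pprt x\<close> and to
  \<open>pprt x - x\<close>, whose difference is \<open>x\<close>.\<close>

lemma band_projection_decomposition:
  fixes x :: "'a::dedekind_complete_vector_lattice"
  assumes B: "band B"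
  shows "band_projection B x \<in> B \<and> x - band_projection B x \<in> disjoint_complement B"
proof -
  have "0 \<le> pprt x" "0 \<le> pprt x - x" by (simp_all add: pprt_def)
  then obtain y z where y: "y \<in> B" "pprt x - y \<in> disjoint_complement B"
    and z: "z \<in> B" "(pprt x - x) - z \<in> disjoint_complement B"
    using band_decomposition_nonneg[OF B] by metis
  have "y - z \<in> B" using y z by - (rule subspace_diff[OF band_subspace[OF B]], auto)
  moreover have "(pprt x - y) - ((pprt x - x) - z) \<in> disjoint_complement B"
    using y z by - (rule subspace_diff[OF subspace_disjoint_complement], auto)
  then have "x - (y - z) \<in> disjoint_complement B" by (simp add: algebra_simps)
  ultimately show ?thesis using band_projectionI[OF B] by metis
qed

lemma linear_band_projection:
  fixes B :: "'a::dedekind_complete_vector_lattice set"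
  assumes B: "band B"
  shows "linear (band_projection B)"
proof (rule linearI)
  note D = band_projection_decomposition[OF B]
  fix x y :: 'a and c :: real
  let ?P = "band_projection B"
  have "(x - ?P x) + (y - ?P y) \<in> disjoint_complement B"
    using D by - (rule subspace_add[OF subspace_disjoint_complement], auto)
  then have "x + y - (?P x + ?P y) \<in> disjoint_complement B" by (simp add: algebra_simps)
  moreover have "?P x + ?P y \<in> B" using D by - (rule subspace_add[OF band_subspace[OF B]], auto)
  ultimately show "?P (x + y) = ?P x + ?P y" by (intro band_projectionI[OF B])
  have "c *\<^sub>R (x - ?P x) \<in> disjoint_complement B"
    using D by - (rule subspace_scale[OF subspace_disjoint_complement], auto)
  moreover have "c *\<^sub>R ?P x \<in> B" using D by - (rule subspace_scale[OF band_subspace[OF B]], auto)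
  ultimately show "?P (c *\<^sub>R x) = c *\<^sub>R ?P x"
    by (intro band_projectionI[OF B]) (simp_all add: algebra_simps)
qed

lemma band_projection_mono:
  assumes "band B" "x \<le> y"
  shows "band_projection B x \<le> band_projection B y"
  using band_projection_nonneg(1)[OF assms(1), of "y - x"] assms(2)
  by (simp add: linear_diff[OF linear_band_projection[OF assms(1)]])

text \<open>The projection onto the larger band fixes the component of \<open>x\<close> in
  \<open>B\<close>. As \<open>x\<close> is nonnegative, this component is below \<open>x\<close>,
  and monotonicity concludes.\<close>

lemma band_projection_subset:
  assumes B: "band B" and C: "band C" and "B \<subseteq> C" "0 \<le> x"
  shows "band_projection B x \<le> band_projection C x"
proof -
  let ?p = "band_projection B x"
  have "?p \<in> C" using band_projection_decomposition[OF B] assms by blast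
  then have "band_projection C ?p = ?p"
    by (intro band_projectionI[OF C])
      (simp_all add: subspace_0[OF subspace_disjoint_complement])
  then show ?thesis
    using band_projection_mono[OF C band_projection_nonneg(2)[OF B \<open>0 \<le> x\<close>]] by simp
qed

text \<open>The remainder \<open>a - pprt a\<close> is minus the positive part of
  \<open>- a\<close>, hence disjoint from the generator of the band.\<close>

lemma band_projection_pprt: "band_projection (band_generated_by (pprt a)) a = pprt a"
proof (rule band_projectionI[OF band_band_generated_by generator_in_band])
  have "a - pprt a = - pprt (- a)"
    using prts[of a] by (simp add: pprt_neg algebra_simps)
  then have "inf \<bar>a - pprt a\<bar> \<bar>pprt a\<bar> = 0"
    using inf_pprt_pprt_uminus[of a] by (simp add: inf_commute)
  then show "a - pprt a \<in> disjoint_complement (band_generated_by (pprt a))"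
    by (rule disjoint_complement_band_generated_by)
qed

section \<open>The maximal inequality\<close>

lemma linear_funpow:
  fixes T :: "'a::real_vector \<Rightarrow> 'a"
  shows "linear T \<Longrightarrow> linear (T ^^ k)"
  by (induction k) (auto intro!: linearI simp: linear_add linear_scale)

lemma positive_operator_mono:
  assumes "positive_operator T" "x \<le> y"
  shows "T x \<le> T y"
proof -
  have "0 \<le> T (y - x)" using assms by (simp add: positive_operator_def)
  then show ?thesis using assms(1) by (simp add: positive_operator_def linear_diff)
qed

lemma positive_functional_mono:
  assumes "positive_functional \<phi>" "x \<le> y"
  shows "\<phi> x \<le> \<phi> y"
proof -
  have "0 \<le> \<phi> (y - x)" using assms by (simp add: positive_functional_def)
  then show ?thesis using assms(1) by (simp add: positive_functional_def linear_diff)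
qed

lemma hopf_maximal:
  fixes T :: "'a::dedekind_complete_vector_lattice \<Rightarrow> 'a" and f :: 'a
  assumes T: "positive_operator T" and phi: "positive_functional \<phi>"
    and sub: "\<And>y. 0 \<le> y \<Longrightarrow> \<phi> (T y) \<le> \<phi> y" and N: "1 \<le> N"
  defines "M \<equiv> pprt (SUP n\<in>{1..N}. \<Sum>k<n. (T ^^ k) f)"
  shows "0 \<le> \<phi> (band_projection (band_generated_by M) f)"
proof -
  define S where "S n = (\<Sum>k<n. (T ^^ k) f)" for n
  define W where "W = (SUP n\<in>{1..N}. S n)"
  have MW: "M = pprt W" by (simp add: M_def W_def S_def)
  let ?P = "band_projection (band_generated_by M)"
  note B = band_band_generated_by[of M]
  have lT: "linear T" using T by (simp add: positive_operator_def)
  have M0: "0 \<le> M" by (simp add: MW)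
  \<comment> \<open>The index 0 is included, with \<open>S 0 = 0\<close> below \<open>M\<close>,
    because the recursion for \<open>S 1\<close> refers back to it.\<close>
  have SM: "S n \<le> M" if "n \<le> N" for n
  proof (cases "n = 0")
    case True
    with M0 show ?thesis by (simp add: S_def)
  next
    case False
    with that have "S n \<le> W"
      unfolding W_def by (intro cSUP_upper bdd_above_finite) auto
    also have "W \<le> M" by (simp add: MW pprt_def)
    finally show ?thesis .
  qed
  have Suc: "S (Suc n) = f + T (S n)" for n
    by (simp add: S_def sum.lessThan_Suc_shift linear_sum[OF lT] del: sum.lessThan_Suc)
  have "W \<le> f + T M"
    unfolding W_def
  proof (rule cSUP_least)
    fix n assume "n \<in> {1..N}"
    then obtain m where "n = Suc m" "m \<le> N" by (cases n) auto
    then show "S n \<le> f + T M"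
      using positive_operator_mono[OF T SM[of m]] by (simp add: Suc)
  qed (use N in auto)
  then have "?P W \<le> ?P (f + T M)" by (rule band_projection_mono[OF B])
  also have "\<dots> = ?P f + ?P (T M)" by (rule linear_add[OF linear_band_projection[OF B]])
  \<comment> \<open>Positivity of \<open>T\<close> makes \<open>T M\<close> nonnegative, so
    projecting can only decrease it.\<close>
  also have "\<dots> \<le> ?P f + T M"
    using T M0 by (intro add_left_mono band_projection_nonneg(2)[OF B])
      (simp add: positive_operator_def)
  finally have "M \<le> ?P f + T M" by (simp add: MW band_projection_pprt)
  then have "\<phi> M \<le> \<phi> (?P f + T M)" by (rule positive_functional_mono[OF phi])
  also have "\<dots> = \<phi> (?P f) + \<phi> (T M)"
    using phi by (simp add: positive_functional_def linear_add)
  finally show ?thesis using sub[OF M0] by simp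
qed

theorem proposition4p2:
  fixes T :: "'a::dedekind_complete_vector_lattice \<Rightarrow> 'a"
    and e x :: 'a
    and \<phi> :: "'a \<Rightarrow> real"
    and lam :: real
    and N :: nat
  assumes "positive_operator T"
    and "superinvariant_pair T e \<phi>"
    and "0 \<le> x"
    and "0 < lam"
    and "1 \<le> N"
  shows "lam * \<phi> (band_projection
           (band_generated_by (SUP n\<in>{1..N}. pprt (cesaro_mean T n x - lam *\<^sub>R e))) e)
         \<le> \<phi> x"
proof -
  define f where "f = x - lam *\<^sub>R e"
  define S where "S n = (\<Sum>k<n. (T ^^ k) f)" for n
  define M where "M = pprt (SUP n\<in>{1..N}. S n)"
  define V where "V n = pprt (cesaro_mean T n x - lam *\<^sub>R e)" for n
  define v where "v = (SUP n\<in>{1..N}. V n)"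
  define P where "P = band_projection (band_generated_by M)"
  have lT: "linear T" using assms(1) by (simp add: positive_operator_def)
  have e: "0 \<le> e" "T e \<le> e"
    and phi: "positive_functional \<phi>"
    and sub: "\<And>y. 0 \<le> y \<Longrightarrow> \<phi> (T y) \<le> \<phi> y"
    using assms(2) by (auto simp: superinvariant_pair_def weak_unit_def)
  have lphi: "linear \<phi>" using phi by (simp add: positive_functional_def)
  note B = band_band_generated_by[of M]
  have lP: "linear P" unfolding P_def by (rule linear_band_projection[OF B])

  have Tk: "(T ^^ k) e \<le> e" for k
  proof (induction k)
    case (Suc k)
    then have "T ((T ^^ k) e) \<le> T e" by (rule positive_operator_mono[OF assms(1)])
    with e show ?case by simp
  qed simp
  \<comment> \<open>After multiplication by \<open>n\<close>, the subtracted term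
    \<open>n * lam * e\<close> dominates \<open>lam\<close> times the sum of the iterates of
    \<open>e\<close>. Replacing it by that sum yields \<open>S n\<close>.\<close>
  have VM: "V n \<le> M" if n: "n \<in> {1..N}" for n
  proof -
    have "S n \<le> (SUP n\<in>{1..N}. S n)" using n by (intro cSUP_upper bdd_above_finite) auto
    also have "\<dots> \<le> M" by (simp add: M_def pprt_def)
    finally have SM: "S n \<le> M" .
    have "(\<Sum>k<n. (T ^^ k) e) \<le> real n *\<^sub>R e"
      using sum_mono[of "{..<n}" "\<lambda>k. (T ^^ k) e" "\<lambda>_. e"] Tk by (simp add: sum_constant_scaleR)
    then have "lam *\<^sub>R (\<Sum>k<n. (T ^^ k) e) \<le> lam *\<^sub>R (real n *\<^sub>R e)"
      using assms(4) by (intro scaleR_left_mono) auto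
    then have "(\<Sum>k<n. (T ^^ k) x) - lam *\<^sub>R (real n *\<^sub>R e)
        \<le> (\<Sum>k<n. (T ^^ k) x) - lam *\<^sub>R (\<Sum>k<n. (T ^^ k) e)"
      by (rule diff_left_mono)
    also have "\<dots> = S n"
      by (simp add: S_def f_def linear_diff[OF linear_funpow[OF lT]]
          linear_scale[OF linear_funpow[OF lT]] sum_subtractf scaleR_sum_right)
    also note SM
    finally have "(\<Sum>k<n. (T ^^ k) x) - lam *\<^sub>R (real n *\<^sub>R e) \<le> M" .
    then have "(1 / real n) *\<^sub>R ((\<Sum>k<n. (T ^^ k) x) - lam *\<^sub>R (real n *\<^sub>R e)) \<le> (1 / real n) *\<^sub>R M"
      by (intro scaleR_left_mono) auto
    \<comment> \<open>The factor \<open>1 / n\<close> is dropped because it is at most 1 and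
      \<open>M\<close> is nonnegative.\<close>
    also have "\<dots> \<le> 1 *\<^sub>R M" using n by (intro scaleR_right_mono) (auto simp: M_def)
    finally have "cesaro_mean T n x - lam *\<^sub>R e \<le> M"
      using n by (simp add: cesaro_mean_def scaleR_diff_right)
    then show ?thesis by (simp add: V_def pprt_def M_def)
  qed
  have "v \<le> M" unfolding v_def using assms(5) VM by (intro cSUP_least) auto
  moreover have "0 \<le> v"
  proof -
    have "0 \<le> V N" by (simp add: V_def)
    also have "\<dots> \<le> v" unfolding v_def using assms(5) by (intro cSUP_upper bdd_above_finite) auto
    finally show ?thesis .
  qed
  \<comment> \<open>Bands are solid, so \<open>0 \<le> v \<le> M\<close> places \<open>v\<close> in
    the band of \<open>M\<close>. Passing to this larger band only increases the projection of
    \<open>e\<close>.\<close>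
  ultimately have "v \<in> band_generated_by M"
    by (intro band_ideal[OF B generator_in_band]) (simp add: abs_of_nonneg)
  then have "band_generated_by v \<subseteq> band_generated_by M"
    by (rule band_generated_by_subset[OF B])
  then have "band_projection (band_generated_by v) e \<le> P e"
    unfolding P_def by (intro band_projection_subset band_band_generated_by e)
  then have "lam * \<phi> (band_projection (band_generated_by v) e) \<le> lam * \<phi> (P e)"
    using assms(4) by (intro mult_left_mono positive_functional_mono[OF phi]) auto
  also have "\<dots> \<le> \<phi> (P x)"
  proof -
    \<comment> \<open>By linearity, with \<open>f = x - lam * e\<close>, this nonnegativity is
      exactly the claimed comparison of \<open>P e\<close> and \<open>P x\<close> under
      \<open>\<phi>\<close>.\<close>
    have "0 \<le> \<phi> (P f)"
      using hopf_maximal[OF assms(1) phi sub assms(5), of f] by (simp add: P_def M_def S_def)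
    then show ?thesis
      by (simp add: f_def linear_diff[OF lP] linear_scale[OF lP] linear_diff[OF lphi] linear_scale[OF lphi])
  qed
  also have "\<dots> \<le> \<phi> x"
    unfolding P_def by (intro positive_functional_mono[OF phi] band_projection_nonneg(2)[OF B] assms(3))
  finally show ?thesis by (simp add: v_def V_def)
qed

end
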